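(* Let $m\ge 1$. A permutation $\pi\in S_{2m+1}$ is $(m+1)$-toppleable if and only if $\pi_i\le m+i$ for $1\le i\le m$ and $\pi_i\ge i-m$ for $m+1\le i\le 2m+1$; equivalently, $\pi^{-1}(i)\in\{1,\dots,m+i\}$ for $1\le i\le m+1$ and $\pi^{-1}(i)\in\{i-m,\dots,2m+1\}$ for $m+2\le i\le 2m+1$. A permutation $\pi\in S_{2m}$ is $(m+1)$-toppleable if and only if $\pi_i\le m+i$ for $1\le i\le m$ and $\pi_i\ge i-m+1$ for $m+1\le i\le 2m$; equivalently, $\pi^{-1}(i)\in\{1,\dots,m+i-1\}$ for $1\le i\le m$ and $\pi^{-1}(i)\in\{i-m,\dots,2m\}$ for $m+1\le i\le 2m$.
   Context: For an integer $n\ge 2$ let $L_n=\{-\lfloor (n+1)/2\rfloor,\dots,\lfloor n/2\rfloor+1\}\subset\mathbb{Z}$; position $0$ is the origin. A toppling move chooses a position $i$ holding at least two chips, chooses two chips $\alpha<\beta$ at $i$, and moves $\alpha$ to $i-1$ and $\beta$ to $i+1$; the toppling process applies such moves (arbitrary choices) until no position holds two or more chips. For $\pi\in S_n$ and $r\in[n+1]$, the initial configuration $\pi^{(r)}$ has, for $j=1,\dots,n$, one chip at position $-\lfloor (n-1)/2\rfloor+j-1$ labeled $\pi_j$ if $\pi_j<r$ and $\pi_j+1$ if $\pi_j\ge r$, plus a chip labeled $r$ at the origin. The final configuration does not depend on the choices and has at most one chip per position; reading chips left to right gives $\mathcal{T}(\pi,r)\in S_{n+1}$. $\pi$ is $r$-toppleable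 if $\mathcal{T}(\pi,r)$ is the identity permutation. *)

theory Defs
  imports Main "HOL-Combinatorics.Permutations"
begin

definition sites :: "nat \<Rightarrow> int set" where
  "sites n = {- ((int n + 1) div 2) .. int n div 2 + 1}"

abbreviation (input) chips :: "nat \<Rightarrow> nat set" where
  "chips n \<equiv> {1..n + 1}"

text \<open>A configuration maps each chip label to the position of that chip; only its values on
  \<open>chips n\<close> matter.\<close>

type_synonym config = "nat \<Rightarrow> int"

text \<open>The condition \<open>{i - 1, i + 1} \<subseteq> sites n\<close> expresses that the process lives on \<open>sites n\<close>. It
  blocks no move from the initial configurations below: until the process stops, no multiply
  occupied position is an endpoint of \<open>sites n\<close>.\<close>

inductive topple :: "nat \<Rightarrow> config \<Rightarrow> config \<Rightarrow> bool" for n where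
  "\<lbrakk>\<alpha> \<in> chips n; \<beta> \<in> chips n; \<alpha> < \<beta>; c \<alpha> = i; c \<beta> = i; {i - 1, i + 1} \<subseteq> sites n\<rbrakk>
    \<Longrightarrow> topple n c (c(\<alpha> := i - 1, \<beta> := i + 1))"

definition stable :: "nat \<Rightarrow> config \<Rightarrow> bool" where
  "stable n c \<longleftrightarrow> inj_on c (chips n)"

definition start_pos :: "nat \<Rightarrow> nat \<Rightarrow> int" where
  "start_pos n j = - ((int n - 1) div 2) + int j - 1"

text \<open>Chip \<open>l \<noteq> r\<close> is the relabelled entry \<open>\<pi> j\<close>, where \<open>\<pi> j = l\<close> if \<open>l < r\<close> and \<open>\<pi> j = l - 1\<close>
  if \<open>l > r\<close>.\<close>

definition init_config :: "nat \<Rightarrow> (nat \<Rightarrow> nat) \<Rightarrow> nat \<Rightarrow> config" where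
  "init_config n \<pi> r l =
     (if l = r then 0
      else if l < r then start_pos n (inv \<pi> l)
      else start_pos n (inv \<pi> (l - 1)))"

text \<open>The labels listed by increasing position, as a function that is the identity outside
  \<open>chips n\<close> (the convention of \<open>permutes\<close>).\<close>

definition reading :: "nat \<Rightarrow> config \<Rightarrow> nat \<Rightarrow> nat" where
  "reading n c j = (if j \<in> chips n then sort_key c [1..<n + 2] ! (j - 1) else j)"

definition toppling_result :: "nat \<Rightarrow> (nat \<Rightarrow> nat) \<Rightarrow> nat \<Rightarrow> nat \<Rightarrow> nat" where
  "toppling_result n \<pi> r =
     (THE \<sigma>. \<exists>c. (topple n)\<^sup>*\<^sup>* (init_config n \<pi> r) c \<and> stable n c \<and> \<sigma> = reading n c)"

definition toppleable :: "nat \<Rightarrow> nat \<Rightarrow> (nat \<Rightarrow> nat) \<Rightarrow> bool" where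
  "toppleable n r \<pi> \<longleftrightarrow> toppling_result n \<pi> r = id"

end

theory Submission
  imports Defs
begin

text \<open>Call \<open>k\<close> an edge if \<open>k\<close> and \<open>k + 1\<close> are both sites, and colour it white if there are as many
  chips as sites in \<open>(-\<infinity>, k]\<close>, black if there is one chip fewer. Initially the white edges are
  exactly those with \<open>k \<ge> 0\<close>, and toppling \<open>i\<close> swaps the colours of the black edge \<open>i - 1\<close> and the
  white edge \<open>i\<close>. In particular no site ever holds three chips, so each site
  admits at most one move; moves at different sites commute, so the stable configuration is unique.

  Consider the condition that every chip \<open>l\<close> has fewer than \<open>l\<close> white edges to its left and fewer
  than \<open>n + 2 - l\<close> black edges to its right. A move \<open>\<alpha> < \<beta>\<close> changes only the left count of \<open>\<beta>\<close>
  and the right count of \<open>\<alpha>\<close>, each by one. Before the move the two chips share a site, hence have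
  equal counts, and the bounds for the other chip of the pair give the room for this increment: the
  condition holds before a move iff it holds after it. For stable configurations it says that
  the reading is the identity, and for the initial ones it is the asserted system of inequalities.\<close>

section \<open>Edge colourings, occupation numbers and the invariant\<close>

definition edges :: "nat \<Rightarrow> int set" where
  "edges n = {- ((int n + 1) div 2) ..< int n div 2 + 1}"

text \<open>\<open>Z\<close> is the set of white edges.\<close>

definition balanced :: "nat \<Rightarrow> config \<Rightarrow> int set \<Rightarrow> bool" where
  "balanced n c Z \<longleftrightarrow> Z \<subseteq> edges n \<and> card Z = n div 2 + 1 \<and>
     (\<forall>i. card {l \<in> chips n. c l = i} = of_bool (i \<in> Z) + of_bool (i - 1 \<in> edges n - Z))"

text \<open>Edge \<open>k\<close> joins the sites \<open>k\<close> and \<open>k + 1\<close>, so the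
  edges to the left of a chip at \<open>x\<close> are those below \<open>x\<close>, and the edge
  \<open>x\<close> itself already lies to its right. This is why one comparison is strict and the
  other is not.\<close>

definition orderly :: "nat \<Rightarrow> config \<Rightarrow> int set \<Rightarrow> bool" where
  "orderly n c Z \<longleftrightarrow>
     (\<forall>l \<in> chips n. card {z \<in> Z. z < c l} < l \<and> card {w \<in> edges n - Z. c l \<le> w} < n + 2 - l)"

text \<open>Termination measure: a move shifts one white edge one step to the left. The offset gives
  the leftmost edge weight 0, so \<open>nat\<close> truncates nothing on
  \<open>edges n\<close>.\<close>

definition potential :: "nat \<Rightarrow> int set \<Rightarrow> nat" where
  "potential n Z = (\<Sum>z\<in>Z. nat (z + (int n + 1) div 2))"

lemma finite_edges [simp]: "finite (edges n)"
  by (simp add: edges_def)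

lemma card_edges: "card (edges n) = n + 1"
proof -
  have "(int n + 1) div 2 + (int n div 2 + 1) = int (n + 1)" by presburger
  then show ?thesis by (simp add: edges_def)
qed

lemma toppleE:
  assumes "topple n c d"
  obtains \<alpha> \<beta> i where "\<alpha> \<in> chips n" "\<beta> \<in> chips n" "\<alpha> < \<beta>" "c \<alpha> = i" "c \<beta> = i"
    "{i - 1, i + 1} \<subseteq> sites n" "d = c(\<alpha> := i - 1, \<beta> := i + 1)"
  using assms by (cases rule: topple.cases) (rule that)

lemma balancedD:
  assumes "balanced n c Z"
  shows "Z \<subseteq> edges n" "finite Z" "card Z = n div 2 + 1" "card (edges n - Z) = (n + 1) div 2"
    "card {l \<in> chips n. c l = i} = of_bool (i \<in> Z) + of_bool (i - 1 \<in> edges n - Z)"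
proof -
  show sub: "Z \<subseteq> edges n" and cZ: "card Z = n div 2 + 1"
    and "card {l \<in> chips n. c l = i} = of_bool (i \<in> Z) + of_bool (i - 1 \<in> edges n - Z)"
    using assms by (simp_all add: balanced_def)
  show "finite Z" by (rule finite_subset[OF sub]) simp
  then show "card (edges n - Z) = (n + 1) div 2"
    using sub cZ card_edges[of n] by (simp add: card_Diff_subset)
qed

text \<open>In a balanced configuration a site owes one chip to a white edge on its right and one to
  a black edge on its left. Two chips therefore force both colours and leave no room for a third
  chip.\<close>

lemma balanced_pair:
  assumes bal: "balanced n c Z" and "\<alpha> \<in> chips n" "\<beta> \<in> chips n" "\<alpha> < \<beta>" "c \<alpha> = i" "c \<beta> = i"
  shows "i \<in> Z" "i - 1 \<in> edges n - Z" "{l \<in> chips n. c l = i} = {\<alpha>, \<beta>}"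
proof -
  have sub: "{\<alpha>, \<beta>} \<subseteq> {l \<in> chips n. c l = i}" using assms by auto
  have "card {\<alpha>, \<beta>} \<le> card {l \<in> chips n. c l = i}"
    by (rule card_mono[OF _ sub]) simp
  then have two: "2 \<le> card {l \<in> chips n. c l = i}" using assms by simp
  then show "i \<in> Z" "i - 1 \<in> edges n - Z"
    using balancedD(5)[OF bal, of i] by (auto simp: of_bool_def split: if_splits)
  then have "card {l \<in> chips n. c l = i} = card {\<alpha>, \<beta>}"
    using balancedD(5)[OF bal, of i] assms by simp
  then show "{l \<in> chips n. c l = i} = {\<alpha>, \<beta>}"
    using card_subset_eq[OF _ sub] by auto
qed

section \<open>Effect of a single move\<close>

text \<open>Only the threshold \<open>x = i\<close> separates \<open>i - 1\<close> from
  \<open>i\<close>; for every other \<open>x\<close> the moved element stays on the same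
  side.\<close>

lemma card_below_shift:
  fixes Z :: "int set"
  assumes "finite Z" "i \<in> Z" "i - 1 \<notin> Z"
  shows "card {z \<in> insert (i - 1) (Z - {i}). z < x} = card {z \<in> Z. z < x} + of_bool (x = i)"
proof -
  have "{z \<in> insert (i - 1) (Z - {i}). z < x} =
      (if x \<le> i - 1 then {z \<in> Z. z < x} else if x = i then insert (i - 1) {z \<in> Z. z < x}
       else insert (i - 1) ({z \<in> Z. z < x} - {i}))"
    by auto
  moreover have "card (insert (i - 1) ({z \<in> Z. z < x} - {i})) = card {z \<in> Z. z < x}" if "x > i"
    using that assms card_Suc_Diff1[of "{z \<in> Z. z < x}" i] by simp
  ultimately show ?thesis using assms by auto
qed

lemma card_above_shift:
  fixes W :: "int set"
  assumes "finite W" "i - 1 \<in> W" "i \<notin> W"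
  shows "card {w \<in> insert i (W - {i - 1}). x \<le> w} = card {w \<in> W. x \<le> w} + of_bool (x = i)"
proof -
  have "{w \<in> insert i (W - {i - 1}). x \<le> w} =
      (if x > i then {w \<in> W. x \<le> w} else if x = i then insert i {w \<in> W. x \<le> w}
       else insert i ({w \<in> W. x \<le> w} - {i - 1}))"
    by auto
  moreover have "card (insert i ({w \<in> W. x \<le> w} - {i - 1})) = card {w \<in> W. x \<le> w}" if "x < i"
    using that assms card_Suc_Diff1[of "{w \<in> W. x \<le> w}" "i - 1"] by simp
  ultimately show ?thesis using assms by auto
qed

text \<open>Collects what one move does: the colouring stays consistent with the chips, the measure
  drops, and \<open>orderly\<close> is preserved in both directions, so that it can be read off at
  the start as well as at the end.\<close>

lemma balanced_topple:
  assumes bal: "balanced n c Z" and top: "topple n c c'"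
  obtains Z' where "balanced n c' Z'" "potential n Z' < potential n Z"
    "orderly n c' Z' \<longleftrightarrow> orderly n c Z"
proof -
  from top obtain \<alpha> \<beta> i where ab: "\<alpha> \<in> chips n" "\<beta> \<in> chips n" "\<alpha> < \<beta>" "c \<alpha> = i" "c \<beta> = i"
    and c': "c' = c(\<alpha> := i - 1, \<beta> := i + 1)"
    by (rule toppleE) blast
  note pair = balanced_pair[OF bal ab]
  define Z' where "Z' = insert (i - 1) (Z - {i})"
  define W where "W = edges n - Z"
  have fin: "finite Z" "finite W" using balancedD(2)[OF bal] by (auto simp: W_def)
  have iE: "i \<in> edges n" using pair(1) balancedD(1)[OF bal] by auto
  have W': "edges n - Z' = insert i (W - {i - 1})"
    using pair(1,2) iE by (auto simp: Z'_def W_def)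
  define A where "A j = {l \<in> chips n. c l = j}" for j
  have A: "finite (A j)" "card (A j) = of_bool (j \<in> Z) + of_bool (j - 1 \<in> W)" for j
    unfolding A_def W_def using balancedD(5)[OF bal] by simp_all
  have notin: "\<alpha> \<notin> A (i - 1)" "\<beta> \<notin> A (i + 1)"
    using ab by (simp_all add: A_def)
  have other: "c l \<noteq> i" if "l \<in> chips n" "l \<noteq> \<alpha>" "l \<noteq> \<beta>" for l
    using pair(3) that by blast
  \<comment> \<open>The pair exhausts the site \<open>i\<close>, so the move leaves it
    empty.\<close>
  have occ: "{l \<in> chips n. c' l = j} =
      (if j = i then {} else if j = i - 1 then insert \<alpha> (A j)
       else if j = i + 1 then insert \<beta> (A j) else A j)" for j
    unfolding A_def using ab other by (auto simp: c' simp del: atLeastAtMost_iff)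
  have "card {l \<in> chips n. c' l = j} = of_bool (j \<in> Z') + of_bool (j - 1 \<in> edges n - Z')" for j
  proof -
    consider "j = i" | "j = i - 1" | "j = i + 1" | "j \<noteq> i" "j \<noteq> i - 1" "j \<noteq> i + 1" by blast
    then show ?thesis
      unfolding occ W' using pair(1,2) notin by cases (simp_all add: Z'_def W_def A)
  qed
  moreover have "Z' \<subseteq> edges n"
    using balancedD(1)[OF bal] pair(1,2) by (auto simp: Z'_def)
  moreover have "card Z' = n div 2 + 1"
    using balancedD(3)[OF bal] pair(1,2) fin card_Suc_Diff1[of Z i] by (simp add: Z'_def)
  ultimately have bal': "balanced n c' Z'" by (simp add: balanced_def)
  have "potential n Z' < potential n Z"
    unfolding potential_def Z'_def sum.remove[OF fin(1) pair(1)]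
    using pair(1,2) fin by (simp add: edges_def)
  moreover have "orderly n c' Z' \<longleftrightarrow> orderly n c Z"
  proof -
    define N M where "N x = card {z \<in> Z. z < x}" and "M x = card {w \<in> W. x \<le> w}" for x
    have N': "card {z \<in> Z'. z < x} = N x + of_bool (x = i)" for x
      unfolding Z'_def N_def using card_below_shift[OF fin(1)] pair(1,2) by simp
    have M': "card {w \<in> edges n - Z'. x \<le> w} = M x + of_bool (x = i)" for x
      unfolding W' M_def using card_above_shift[OF fin(2)] pair(1,2) by (simp add: W_def)
    \<comment> \<open>The next facts, up to \<open>M2\<close>, record that crossing the black edge
      \<open>i - 1\<close> changes only the black count and crossing the white edge \<open>i\<close>
      only the white count.\<close>
    have "z < i - 1 \<longleftrightarrow> z < i" if "z \<in> Z" for z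
      using that pair(2) by (cases "z = i - 1") auto
    then have N1: "N (i - 1) = N i" unfolding N_def by (metis (lifting))
    have "z < i + 1 \<longleftrightarrow> z = i \<or> z < i" for z by auto
    then have "{z \<in> Z. z < i + 1} = insert i {z \<in> Z. z < i}" using pair(1) by blast
    then have N2: "N (i + 1) = Suc (N i)" using fin by (simp add: N_def)
    have "i - 1 \<le> w \<longleftrightarrow> w = i - 1 \<or> i \<le> w" for w by auto
    then have "{w \<in> W. i - 1 \<le> w} = insert (i - 1) {w \<in> W. i \<le> w}"
      using pair(2) unfolding W_def by blast
    then have M1: "M (i - 1) = Suc (M i)" using fin by (simp add: M_def)
    have "i + 1 \<le> w \<longleftrightarrow> i \<le> w" if "w \<in> W" for w
      using that pair(1) by (cases "w = i") (auto simp: W_def)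
    then have M2: "M (i + 1) = M i" unfolding M_def by (metis (lifting))
    have split: "(\<forall>l\<in>chips n. P l) \<longleftrightarrow> P \<alpha> \<and> P \<beta> \<and> (\<forall>l\<in>chips n - {\<alpha>, \<beta>}. P l)" for P
      using ab by blast
    have "orderly n c' Z' \<longleftrightarrow>
        (N i < \<alpha> \<and> M i + 1 < n + 2 - \<alpha>) \<and> (N i + 1 < \<beta> \<and> M i < n + 2 - \<beta>) \<and>
        (\<forall>l\<in>chips n - {\<alpha>, \<beta>}. N (c l) < l \<and> M (c l) < n + 2 - l)"
      unfolding orderly_def N' M' split using ab other by (simp add: c' N1 N2 M1 M2)
    \<comment> \<open>Since \<open>\<alpha> < \<beta>\<close>, the bound
      \<open>N i < \<alpha>\<close> yields \<open>N i + 1 < \<beta>\<close>, and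
      \<open>M i < n + 2 - \<beta>\<close> yields \<open>M i + 1 < n + 2 - \<alpha>\<close>.\<close>
    also have "\<dots> \<longleftrightarrow> (N i < \<alpha> \<and> M i < n + 2 - \<alpha>) \<and> (N i < \<beta> \<and> M i < n + 2 - \<beta>) \<and>
        (\<forall>l\<in>chips n - {\<alpha>, \<beta>}. N (c l) < l \<and> M (c l) < n + 2 - l)"
      using ab by auto
    also have "\<dots> \<longleftrightarrow> orderly n c Z"
      unfolding orderly_def N_def[symmetric] W_def[symmetric] M_def[symmetric] split
      using ab by simp
    finally show ?thesis .
  qed
  ultimately show thesis using bal' that by blast
qed

section \<open>Termination and uniqueness of the stable configuration\<close>

text \<open>A site with a movable pair holds nothing else, so different moves act at different
  sites, hence on disjoint pairs, and can be performed in either order.\<close>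

lemma topple_diamond:
  assumes bal: "balanced n c Z" and "topple n c d1" "topple n c d2" "d1 \<noteq> d2"
  obtains e where "topple n d1 e" "topple n d2 e"
proof -
  from assms(2) obtain \<alpha> \<beta> i where 1: "\<alpha> \<in> chips n" "\<beta> \<in> chips n" "\<alpha> < \<beta>" "c \<alpha> = i" "c \<beta> = i"
    "{i - 1, i + 1} \<subseteq> sites n" "d1 = c(\<alpha> := i - 1, \<beta> := i + 1)"
    by (rule toppleE)
  from assms(3) obtain \<gamma> \<delta> j where 2: "\<gamma> \<in> chips n" "\<delta> \<in> chips n" "\<gamma> < \<delta>" "c \<gamma> = j" "c \<delta> = j"
    "{j - 1, j + 1} \<subseteq> sites n" "d2 = c(\<gamma> := j - 1, \<delta> := j + 1)"
    by (rule toppleE)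
  have "i \<noteq> j"
  proof
    assume "i = j"
    then have "{\<alpha>, \<beta>} = {\<gamma>, \<delta>}"
      using balanced_pair(3)[OF bal 1(1-5)] balanced_pair(3)[OF bal 2(1-5)] by simp
    with 1(3) 2(3) have "\<alpha> = \<gamma>" "\<beta> = \<delta>" by (auto simp: doubleton_eq_iff)
    with \<open>i = j\<close> 1 2 \<open>d1 \<noteq> d2\<close> show False by simp
  qed
  then have ne: "\<alpha> \<noteq> \<gamma>" "\<alpha> \<noteq> \<delta>" "\<beta> \<noteq> \<gamma>" "\<beta> \<noteq> \<delta>" using 1 2 by auto
  have "topple n d1 (d1(\<gamma> := j - 1, \<delta> := j + 1))"
    by (rule topple.intros) (use 1 2 ne in auto)
  moreover have "topple n d2 (d2(\<alpha> := i - 1, \<beta> := i + 1))"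
    by (rule topple.intros) (use 1 2 ne in auto)
  moreover have "d2(\<alpha> := i - 1, \<beta> := i + 1) = d1(\<gamma> := j - 1, \<delta> := j + 1)"
    using 1 2 ne by (auto simp: fun_eq_iff)
  ultimately show thesis using that by simp
qed

lemma stable_topple:
  assumes "stable n c"
  shows "\<not> topple n c d"
proof
  assume "topple n c d"
  then obtain \<alpha> \<beta> where "\<alpha> \<in> chips n" "\<beta> \<in> chips n" "\<alpha> < \<beta>" "c \<alpha> = c \<beta>"
    by (rule toppleE) simp
  then show False using assms unfolding stable_def by (metis inj_onD less_irrefl)
qed

text \<open>The boundary condition in \<open>topple\<close> never blocks: a site with two chips has
  an edge on each side, so both of its neighbours are sites.\<close>

lemma unstable_topple:
  assumes bal: "balanced n c Z" and "\<not> stable n c"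
  obtains d where "topple n c d"
proof -
  from assms(2) obtain \<alpha> \<beta> where ab: "\<alpha> \<in> chips n" "\<beta> \<in> chips n" "\<alpha> < \<beta>" "c \<alpha> = c \<beta>"
    unfolding stable_def by (metis linorder_inj_onI')
  have "c \<beta> \<in> Z" "c \<beta> - 1 \<in> edges n"
    using balanced_pair(1,2)[OF bal ab refl] by auto
  then have "{c \<beta> - 1, c \<beta> + 1} \<subseteq> sites n"
    using balancedD(1)[OF bal] by (auto simp: edges_def sites_def)
  then show thesis using topple.intros[OF ab refl] that by blast
qed

text \<open>Newman's argument by induction on \<open>potential\<close>: two first moves either agree
  or are joined by one further move each.\<close>

lemma ex1_stable:
  assumes "balanced n c Z"
  shows "\<exists>!d. (topple n)\<^sup>*\<^sup>* c d \<and> stable n d"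
  using assms
proof (induction "potential n Z" arbitrary: c Z rule: less_induct)
  case less
  have IH: "\<exists>!e. (topple n)\<^sup>*\<^sup>* d e \<and> stable n e" if "topple n c d" for d
    using balanced_topple[OF less.prems that] less.hyps by metis
  show ?case
  proof (cases "stable n c")
    case True
    then show ?thesis
      using stable_topple by (metis converse_rtranclpE rtranclp.rtrancl_refl)
  next
    case False
    then obtain d where cd: "topple n c d" using unstable_topple[OF less.prems] by blast
    from IH[OF cd] obtain e where e: "(topple n)\<^sup>*\<^sup>* d e" "stable n e"
      and uniq: "\<And>e'. (topple n)\<^sup>*\<^sup>* d e' \<Longrightarrow> stable n e' \<Longrightarrow> e' = e"
      by blast
    show ?thesis
    proof (intro ex1I conjI)
      show "(topple n)\<^sup>*\<^sup>* c e" using cd e by (meson converse_rtranclp_into_rtranclp)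
      show "stable n e" by fact
      fix e' assume e': "(topple n)\<^sup>*\<^sup>* c e' \<and> stable n e'"
      with False obtain d' where d': "topple n c d'" "(topple n)\<^sup>*\<^sup>* d' e'"
        by (metis converse_rtranclpE)
      show "e' = e"
      proof (cases "d' = d")
        case True
        with uniq d' e' show ?thesis by blast
      next
        case False
        with topple_diamond[OF less.prems d'(1) cd] obtain f where f: "topple n d' f" "topple n d f"
          by blast
        obtain Z' where Z': "balanced n d' Z'" "potential n Z' < potential n Z"
          using balanced_topple[OF less.prems d'(1)] by blast
        obtain Z'' where Z'': "balanced n f Z''" "potential n Z'' < potential n Z'"
          using balanced_topple[OF Z'(1) f(1)] by blast
        obtain g where g: "(topple n)\<^sup>*\<^sup>* f g" "stable n g"
          using less.hyps[OF _ Z''(1)] Z'(2) Z''(2) by (meson order.strict_trans)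
        \<comment> \<open>\<open>g\<close> is reachable through \<open>d\<close> and through
          \<open>d'\<close>; uniqueness below each of them identifies it with \<open>e\<close> and
          with \<open>e'\<close>.\<close>
        have "g = e" using uniq f(2) g by (meson converse_rtranclp_into_rtranclp)
        moreover have "(topple n)\<^sup>*\<^sup>* d' g"
          using f(1) g(1) by (rule converse_rtranclp_into_rtranclp)
        then have "g = e'"
          using IH[OF d'(1)] d'(2) e' g(2) by blast
        ultimately show ?thesis by simp
      qed
    qed
  qed
qed

lemma balanced_topples:
  assumes "(topple n)\<^sup>*\<^sup>* c c'" "balanced n c Z"
  shows "\<exists>Z'. balanced n c' Z' \<and> (orderly n c' Z' \<longleftrightarrow> orderly n c Z)"
  using assms
proof (induction rule: rtranclp_induct)
  case base
  then show ?case by blast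
next
  case (step d e)
  then show ?case using balanced_topple by (metis (no_types, lifting))
qed

section \<open>Stable configurations with identity reading\<close>

text \<open>\<open>sort_key\<close> leaves a list fixed exactly when it is already sorted by the
  key. List index \<open>i\<close> carries the label \<open>i + 1\<close>.\<close>

lemma reading_eq_id_iff:
  "reading n c = id \<longleftrightarrow> (\<forall>k\<in>chips n. \<forall>l\<in>chips n. k \<le> l \<longrightarrow> c k \<le> c l)"
proof -
  have "reading n c = id \<longleftrightarrow> (\<forall>i < n + 1. sort_key c [1..<n + 2] ! i = i + 1)"
  proof (intro iffI allI impI ext)
    fix i assume "reading n c = id" "i < n + 1"
    then show "sort_key c [1..<n + 2] ! i = i + 1"
      by (auto simp del: upt_Suc simp: reading_def dest: fun_cong[where x = "i + 1"])
  next
    fix j assume "\<forall>i < n + 1. sort_key c [1..<n + 2] ! i = i + 1"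
    from this[rule_format, of "j - 1"] show "reading n c j = id j"
      by (auto simp del: upt_Suc simp: reading_def)
  qed
  also have "\<dots> \<longleftrightarrow> sort_key c [1..<n + 2] = [1..<n + 2]"
    by (auto simp del: upt_Suc simp: list_eq_iff_nth_eq)
  also have "\<dots> \<longleftrightarrow> sorted (map c [1..<n + 2])"
    by (metis sort_key_id_if_sorted sorted_sort_key)
  also have "\<dots> \<longleftrightarrow> (\<forall>k\<in>chips n. \<forall>l\<in>chips n. k \<le> l \<longrightarrow> c k \<le> c l)"
  proof
    assume *: "sorted (map c [1..<n + 2])"
    show "\<forall>k\<in>chips n. \<forall>l\<in>chips n. k \<le> l \<longrightarrow> c k \<le> c l"
    proof (intro ballI impI)
      fix k l assume "k \<in> chips n" "l \<in> chips n" "k \<le> l"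
      with sorted_nth_mono[OF *, of "k - 1" "l - 1"] show "c k \<le> c l"
        by (auto simp del: upt_Suc)
    qed
  qed (auto simp del: upt_Suc simp: sorted_iff_nth_mono)
  finally show ?thesis .
qed

text \<open>A white edge \<open>z\<close> guarantees a chip at \<open>z\<close>, a black edge
  \<open>w\<close> a chip at \<open>w + 1\<close>. If labels increase with position, the white edges
  left of chip \<open>l\<close> are thus paid for by labels below \<open>l\<close>, and the black
  edges right of it by labels above \<open>l\<close>.\<close>

lemma orderly_if_reading_id:
  assumes bal: "balanced n c Z" and id: "reading n c = id"
  shows "orderly n c Z"
  unfolding orderly_def
proof (intro ballI conjI)
  fix l assume l: "l \<in> chips n"
  have mono: "c j \<le> c k" if "j \<in> chips n" "k \<in> chips n" "j \<le> k" for j k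
    using id that by (auto simp: reading_eq_id_iff)
  have occ: "\<exists>k\<in>chips n. c k = i" if "i \<in> Z \<or> i - 1 \<in> edges n - Z" for i
  proof (rule ccontr)
    assume "\<not> (\<exists>k\<in>chips n. c k = i)"
    then have "{k \<in> chips n. c k = i} = {}" by blast
    then have "card {k \<in> chips n. c k = i} = 0" by (simp only: card.empty)
    then show False unfolding balancedD(5)[OF bal] using that by auto
  qed
  have "{z \<in> Z. z < c l} \<subseteq> c ` {k \<in> chips n. c k < c l}" using occ by force
  also have "{k \<in> chips n. c k < c l} \<subseteq> {1..<l}"
    using mono[OF l] by (force simp: not_less[symmetric])
  finally have "{z \<in> Z. z < c l} \<subseteq> c ` {1..<l}" by blast
  from surj_card_le[OF _ this] show "card {z \<in> Z. z < c l} < l" using l by auto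
  have "{w \<in> edges n - Z. c l \<le> w} \<subseteq> (\<lambda>k. c k - 1) ` {k \<in> chips n. c l < c k}"
  proof
    fix w assume w: "w \<in> {w \<in> edges n - Z. c l \<le> w}"
    then obtain k where "k \<in> chips n" "c k = w + 1" using occ[of "w + 1"] by auto
    then show "w \<in> (\<lambda>k. c k - 1) ` {k \<in> chips n. c l < c k}" using w by force
  qed
  also have "{k \<in> chips n. c l < c k} \<subseteq> {l<..n + 1}"
    using mono[OF _ l] by (force simp: not_less[symmetric])
  finally have "{w \<in> edges n - Z. c l \<le> w} \<subseteq> (\<lambda>k. c k - 1) ` {l<..n + 1}" by blast
  from surj_card_le[OF _ this] show "card {w \<in> edges n - Z. c l \<le> w} < n + 2 - l"
    using l by (auto simp: Suc_diff_le less_Suc_eq_le)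
qed

lemma card_filter_less:
  assumes "card {x \<in> S. P x} < card S"
  shows "\<exists>x\<in>S. \<not> P x"
proof (rule ccontr)
  assume "\<not> ?thesis"
  then have "{x \<in> S. P x} = S" by blast
  with assms show False by simp
qed

text \<open>Stability pushes all white edges to the left of all black ones. The bounds then confine
  the labels up to \<open>q\<close> from above and the remaining ones from below; injectivity turns
  these estimates into exact positions, with the site \<open>q - p\<close> left empty.\<close>

lemma reading_id_if_orderly:
  assumes bal: "balanced n c Z" and stable: "stable n c" and ord: "orderly n c Z"
  shows "reading n c = id"
proof -
  \<comment> \<open>\<open>p\<close> counts the black edges and \<open>q\<close> the white ones; the
    sites are \<open>-p\<close> to \<open>q\<close>.\<close>
  define p where "p = (n + 1) div 2"
  define q where "q = n div 2 + 1"
  have pq: "p + q = n + 1" by (simp add: p_def q_def)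
  have E: "edges n = {- int p..<int q}" by (simp add: edges_def p_def q_def zdiv_int add.commute)
  have inj: "inj_on c (chips n)" using stable by (simp add: stable_def)
  \<comment> \<open>A black edge directly followed by a white one would put two chips on the site
    between them.\<close>
  have pred: "i - 1 \<in> Z" if "i \<in> Z" "i - 1 \<in> edges n" for i
  proof (rule ccontr)
    assume "i - 1 \<notin> Z"
    then have "card {l \<in> chips n. c l = i} = Suc (Suc 0)"
      using balancedD(5)[OF bal, of i] that by simp
    then obtain a b where "{l \<in> chips n. c l = i} = {a, b}" "a \<noteq> b"
      by (metis card_2_iff numeral_2_eq_2)
    then have "a \<in> chips n" "b \<in> chips n" "c a = i" "c b = i" by blast+
    with inj \<open>a \<noteq> b\<close> show False by (auto dest: inj_onD)
  qed
  have down: "y \<in> Z" if "z \<in> Z" "y \<le> z" "- int p \<le> y" for y z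
    using that(2,3)
  proof (induction rule: int_le_induct)
    case base
    then show ?case using that by simp
  next
    case (step i)
    then show ?case using pred[of i] balancedD(1)[OF bal] E by auto
  qed
  have sites: "- int p \<le> c l" "c l \<le> int q" if "l \<in> chips n" for l
  proof -
    have "{k \<in> chips n. c k = c l} \<noteq> {}" using that by blast
    then have "card {k \<in> chips n. c k = c l} \<noteq> 0" by simp
    then have "c l \<in> edges n \<or> c l - 1 \<in> edges n"
      using balancedD(1)[OF bal] balancedD(5)[OF bal, of "c l"] by (auto simp: of_bool_def split: if_splits)
    then show "- int p \<le> c l" "c l \<le> int q" by (auto simp: E)
  qed
  \<comment> \<open>Fewer than \<open>q\<close> white edges lie to the left, so some white edge lies
    to the right; by \<open>down\<close> every edge to the left is then white, and the bound counts
    them all.\<close>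
  have low_le: "c l \<le> int l - int p - 1" if l: "l \<in> chips n" "l \<le> q" for l
  proof -
    have lt: "card {z \<in> Z. z < c l} < l" using ord l by (auto simp: orderly_def)
    then have "card {z \<in> Z. z < c l} < card Z" using l(2) balancedD(3)[OF bal] by (simp add: q_def)
    from card_filter_less[OF this] obtain z where "z \<in> Z" "\<not> z < c l" by blast
    then have "{- int p..<c l} \<subseteq> {z \<in> Z. z < c l}" using down[of z] by auto
    from card_mono[OF _ this] have "nat (c l + int p) < l"
      using lt balancedD(2)[OF bal] by simp
    then show ?thesis by linarith
  qed
  \<comment> \<open>Mirror image: some black edge lies to the left, so every edge to the right is
    black.\<close>
  have high_ge: "int l - int p \<le> c l" if l: "l \<in> chips n" "q < l" for l
  proof -
    have lt: "card {w \<in> edges n - Z. c l \<le> w} < n + 2 - l" using ord l by (auto simp: orderly_def)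
    moreover have "n + 2 - l \<le> p" using l(2) pq by simp
    ultimately have "card {w \<in> edges n - Z. c l \<le> w} < card (edges n - Z)"
      using balancedD(4)[OF bal] by (simp add: p_def)
    from card_filter_less[OF this] obtain w where "w \<in> edges n - Z" "\<not> c l \<le> w" by blast
    then have "x \<notin> Z" if "c l \<le> x" for x using down[of x w] that by (auto simp: E)
    moreover have "- int p \<le> c l" using sites l by blast
    ultimately have "{c l..<int q} \<subseteq> {w \<in> edges n - Z. c l \<le> w}" by (auto simp: E)
    from card_mono[OF _ this] have "nat (int q - c l) < n + 2 - l" using lt by simp
    then show ?thesis using pq l by auto
  qed
  have low: "c l = int l - int p - 1" if "l \<in> chips n" "l \<le> q" for l
    using that
  proof (induction l rule: less_induct)
    case (less l)
    show ?case
    proof (rule ccontr)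
      assume "c l \<noteq> int l - int p - 1"
      then have lt: "c l < int l - int p - 1" using low_le[OF less.prems] by simp
      \<comment> \<open>\<open>k\<close> is the label whose claimed site is \<open>c l\<close>. It
        is smaller than \<open>l\<close>, so by induction it already sits there.\<close>
      define k where "k = nat (c l + int p + 1)"
      have k: "k < l" "k \<in> chips n" "int k = c l + int p + 1"
        using lt sites(1)[OF less.prems(1)] less.prems by (auto simp: k_def)
      then have "c k = c l" using less.IH[of k] less.prems by simp
      with k inj less.prems show False by (auto dest: inj_onD)
    qed
  qed
  have high: "c l = int l - int p" if "l \<in> chips n" "q < l" for l
    using that
  \<comment> \<open>This time the induction descends from label \<open>n + 1\<close>, filling sites
    from the right end.\<close>
  proof (induction "n + 1 - l" arbitrary: l rule: less_induct)
    case less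
    show ?case
    proof (rule ccontr)
      assume "c l \<noteq> int l - int p"
      then have gt: "int l - int p < c l" using high_ge[OF less.prems] by simp
      define k where "k = nat (c l + int p)"
      have k: "l < k" "k \<in> chips n" "int k = c l + int p"
        using gt sites(2)[OF less.prems(1)] less.prems pq by (auto simp: k_def)
      then have "c k = c l" using less.hyps[of k] less.prems by simp
      with k inj less.prems show False by (auto dest: inj_onD)
    qed
  qed
  show ?thesis
    unfolding reading_eq_id_iff
  proof (intro ballI impI)
    fix k l assume "k \<in> chips n" "l \<in> chips n" "k \<le> l"
    then show "c k \<le> c l"
      using low[of k] low[of l] high[of k] high[of l] by (cases "l \<le> q"; cases "k \<le> q") auto
  qed
qed

lemma toppleable_iff_orderly:
  assumes bal: "balanced n (init_config n \<pi> r) Z"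
  shows "toppleable n r \<pi> \<longleftrightarrow> orderly n (init_config n \<pi> r) Z"
proof -
  let ?c = "init_config n \<pi> r"
  obtain d where d: "(topple n)\<^sup>*\<^sup>* ?c d" "stable n d"
    and uniq: "\<And>d'. (topple n)\<^sup>*\<^sup>* ?c d' \<Longrightarrow> stable n d' \<Longrightarrow> d' = d"
    using ex1_stable[OF bal] by blast
  have "toppling_result n \<pi> r = reading n d"
    unfolding toppling_result_def by (rule the_equality) (use d uniq in blast)+
  moreover obtain Z' where "balanced n d Z'" "orderly n d Z' \<longleftrightarrow> orderly n ?c Z"
    using balanced_topples[OF d(1) bal] by blast
  ultimately show ?thesis
    unfolding toppleable_def using d(2) orderly_if_reading_id reading_id_if_orderly by metis
qed

section \<open>The initial configuration\<close>

text \<open>Forward direction of the relabelling that \<open>init_config\<close> inverts; it lets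
  the chips other than \<open>r\<close> be indexed by their place \<open>j\<close> in
  \<open>\<pi>\<close>.\<close>

definition chip_label :: "nat \<Rightarrow> nat \<Rightarrow> nat" where
  "chip_label r k = (if k < r then k else k + 1)"

lemma chip_label_bij:
  assumes "r \<in> chips n"
  shows "bij_betw (chip_label r) {1..n} (chips n - {r})"
proof (rule bij_betw_imageI)
  show "inj_on (chip_label r) {1..n}" by (auto simp: inj_on_def chip_label_def split: if_splits)
  show "chip_label r ` {1..n} = chips n - {r}"
  proof (intro equalityI subsetI)
    fix l assume l: "l \<in> chips n - {r}"
    show "l \<in> chip_label r ` {1..n}"
    proof (cases "l < r")
      case True
      with l assms show ?thesis by (intro image_eqI[of _ _ l]) (auto simp: chip_label_def)
    next
      case False
      with l assms show ?thesis by (intro image_eqI[of _ _ "l - 1"]) (auto simp: chip_label_def)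
    qed
  qed (auto simp: chip_label_def split: if_splits)
qed

lemma init_config_origin: "init_config n \<pi> r r = 0"
  by (simp add: init_config_def)

lemma init_config_chip_label: "init_config n \<pi> r (chip_label r k) = start_pos n (inv \<pi> k)"
  by (simp add: init_config_def chip_label_def)

lemma chips_conv:
  assumes "\<pi> permutes {1..n}" "r \<in> chips n"
  shows "chips n = insert r ((\<lambda>j. chip_label r (\<pi> j)) ` {1..n})"
proof -
  have "(\<lambda>j. chip_label r (\<pi> j)) ` {1..n} = chip_label r ` \<pi> ` {1..n}" by (simp add: image_image)
  also have "\<dots> = chips n - {r}"
    using permutes_image[OF assms(1)] bij_betw_imp_surj_on[OF chip_label_bij[OF assms(2)]] by simp
  finally show ?thesis using assms(2) by blast
qed

lemma init_config_start:
  assumes "\<pi> permutes S"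
  shows "init_config n \<pi> r (chip_label r (\<pi> j)) = start_pos n j"
  by (simp add: init_config_chip_label permutes_inverses(2)[OF assms])

text \<open>The entries of \<open>\<pi>\<close> occupy each site strictly between the two end sites
  once, and chip \<open>r\<close> adds one at the origin, where the colour changes from black to
  white.\<close>

lemma balanced_init:
  assumes perm: "\<pi> permutes {1..n}" and r: "r \<in> chips n"
  shows "balanced n (init_config n \<pi> r) {0..<int n div 2 + 1}"
proof -
  let ?c = "init_config n \<pi> r" and ?f = "\<lambda>j. chip_label r (\<pi> j)"
  have half: "(int n - 1) div 2 = (int n + 1) div 2 - 1"
    "(int n + 1) div 2 + (int n div 2 + 1) = int n + 1" by presburger+
  have f_ne: "?f j \<noteq> r" for j by (simp add: chip_label_def)
  have inj: "inj ?f"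
  proof (rule injI)
    fix x y assume "?f x = ?f y"
    then have "\<pi> x = \<pi> y" by (simp add: chip_label_def split: if_splits)
    then show "x = y" using permutes_inj[OF perm] by (simp add: inj_eq)
  qed
  have "card {l \<in> chips n. ?c l = i} =
      of_bool (i \<in> {0..<int n div 2 + 1}) + of_bool (i - 1 \<in> edges n - {0..<int n div 2 + 1})" for i
  proof -
    define J where "J = {j \<in> {1..n}. start_pos n j = i}"
    have J: "J = (if i \<in> {- ((int n + 1) div 2) <..< int n div 2 + 1}
        then {nat (i + (int n + 1) div 2)} else {})"
      using half by (auto simp: J_def start_pos_def)
    have "{l \<in> chips n. ?c l = i} = (if i = 0 then {r} else {}) \<union> ?f ` J"
      unfolding chips_conv[OF perm r] J_def
      using init_config_start[OF perm] init_config_origin by auto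
    moreover have "r \<notin> ?f ` J" using f_ne by (metis imageE)
    moreover have "card (?f ` J) = card J"
      using inj by (intro card_image) (auto intro: inj_on_subset)
    moreover have "finite J" by (simp add: J_def)
    ultimately have occ: "card {l \<in> chips n. ?c l = i} = of_bool (i = 0) + card J"
      by simp
    have count: "of_bool (i = 0) + card (if i \<in> {- p<..<q} then {k} else {}) =
        of_bool (i \<in> {0..<q}) + of_bool (i - 1 \<in> {- p..<q} - {0..<q})"
      if "0 \<le> p" "0 < q" for p q :: int and k :: nat
      using that by (cases "i = 0"; cases "0 \<le> i") (simp_all add: of_bool_def)
    show ?thesis unfolding occ J edges_def by (rule count) auto
  qed
  moreover have "{0..<int n div 2 + 1} \<subseteq> edges n" by (auto simp: edges_def)
  moreover have "card {0..<int n div 2 + 1} = n div 2 + 1" by simp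
  ultimately show ?thesis by (simp add: balanced_def)
qed

text \<open>In the initial colouring a chip at \<open>x \<ge> 0\<close> has \<open>x\<close> white
  edges to its left and no black edge to its right; a chip at \<open>x < 0\<close> has no white edge
  to its left and \<open>-x\<close> black edges to its right. Chip \<open>r\<close> at the origin
  meets both bounds automatically.\<close>

lemma toppleable_iff:
  assumes perm: "\<pi> permutes {1..n}" and r: "r \<in> chips n"
  shows "toppleable n r \<pi> \<longleftrightarrow>
    (\<forall>j\<in>{1..n}. start_pos n j < int (chip_label r (\<pi> j)) \<and>
       int (chip_label r (\<pi> j)) < start_pos n j + int n + 2)"
proof -
  let ?c = "init_config n \<pi> r" and ?f = "\<lambda>j. chip_label r (\<pi> j)"
  define p q where "p = (int n + 1) div 2" and "q = int n div 2 + 1"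
  have half: "(int n - 1) div 2 = p - 1" "p + q = int n + 1"
    unfolding p_def q_def by presburger+
  have key: "card {z \<in> {0..<q}. z < x} < l \<and> card {w \<in> edges n - {0..<q}. x \<le> w} < n + 2 - l
      \<longleftrightarrow> x < int l \<and> int l < x + int n + 2"
    if "- p \<le> x" "x < q" "l \<in> chips n" for x l
  proof -
    have "{z \<in> {0..<q}. z < x} = {0..<x}" "{w \<in> edges n - {0..<q}. x \<le> w} = {x..<0}"
      using that by (auto simp: edges_def p_def q_def)
    then show ?thesis using that by auto
  qed
  have start: "- p \<le> start_pos n j" "start_pos n j < q" if "j \<in> {1..n}" for j
    using that half by (auto simp: start_pos_def)
  have mem: "?f j \<in> chips n" if "j \<in> {1..n}" for j
    unfolding chips_conv[OF perm r] using that by blast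
  have "0 \<le> p" "0 < q" by (auto simp: p_def q_def)
  note keyr = key[of 0 r, OF _ _ r]
  have "toppleable n r \<pi> \<longleftrightarrow> orderly n ?c {0..<q}"
    unfolding q_def by (rule toppleable_iff_orderly[OF balanced_init[OF perm r]])
  also have "\<dots> \<longleftrightarrow> (\<forall>l\<in>insert r (?f ` {1..n}).
      card {z \<in> {0..<q}. z < ?c l} < l \<and> card {w \<in> edges n - {0..<q}. ?c l \<le> w} < n + 2 - l)"
    unfolding orderly_def chips_conv[OF perm r, symmetric] ..
  also have "\<dots> \<longleftrightarrow> (\<forall>j\<in>{1..n}. start_pos n j < int (?f j) \<and> int (?f j) < start_pos n j + int n + 2)"
    unfolding ball_simps init_config_origin init_config_start[OF perm]
    using keyr key[OF start mem] r \<open>0 \<le> p\<close> \<open>0 < q\<close> by simp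
  finally show ?thesis .
qed

section \<open>Specialisation to \<open>r = m + 1\<close> in odd and even length\<close>

lemma ball_split:
  fixes k n :: nat
  assumes "k \<le> n"
  shows "(\<forall>i\<in>{1..k}. A i) \<and> (\<forall>i\<in>{k + 1..n}. B i) \<longleftrightarrow> (\<forall>i\<in>{1..n}. if i \<le> k then A i else B i)"
  using assms by fastforce

text \<open>Substitution \<open>i = \<pi> j\<close>, which turns conditions on the inverse into
  conditions on \<open>\<pi>\<close>.\<close>

lemma ball_permutes_inv:
  assumes "\<pi> permutes S"
  shows "(\<forall>i\<in>S. P i (inv \<pi> i)) \<longleftrightarrow> (\<forall>j\<in>S. P (\<pi> j) j)"
  using permutes_inverses[OF assms] permutes_in_image[OF assms] permutes_in_image[OF permutes_inv[OF assms]]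
  by metis

theorem theorem3p4:
  fixes m :: nat
  assumes "m \<ge> 1"
  shows "(\<forall>\<pi>. \<pi> permutes {1..2 * m + 1} \<longrightarrow>
            (toppleable (2 * m + 1) (m + 1) \<pi> \<longleftrightarrow>
               (\<forall>i\<in>{1..m}. \<pi> i \<le> m + i) \<and> (\<forall>i\<in>{m + 1..2 * m + 1}. \<pi> i \<ge> i - m))
            \<and> (toppleable (2 * m + 1) (m + 1) \<pi> \<longleftrightarrow>
               (\<forall>i\<in>{1..m + 1}. inv \<pi> i \<in> {1..m + i}) \<and>
               (\<forall>i\<in>{m + 2..2 * m + 1}. inv \<pi> i \<in> {i - m..2 * m + 1})))
       \<and> (\<forall>\<pi>. \<pi> permutes {1..2 * m} \<longrightarrow>
            (toppleable (2 * m) (m + 1) \<pi> \<longleftrightarrow>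
               (\<forall>i\<in>{1..m}. \<pi> i \<le> m + i) \<and> (\<forall>i\<in>{m + 1..2 * m}. \<pi> i \<ge> i - m + 1))
            \<and> (toppleable (2 * m) (m + 1) \<pi> \<longleftrightarrow>
               (\<forall>i\<in>{1..m}. inv \<pi> i \<in> {1..m + i - 1}) \<and>
               (\<forall>i\<in>{m + 1..2 * m}. inv \<pi> i \<in> {i - m..2 * m})))"
proof (intro conjI allI impI)
  fix \<pi> :: "nat \<Rightarrow> nat" assume perm: "\<pi> permutes {1..2 * m + 1}"
  define n where "n = 2 * m + 1"
  note perm = perm[folded n_def]
  have n: "m \<le> n" "m + 1 \<le> n" "m + 1 \<in> chips n" by (auto simp: n_def)
  have start: "start_pos n j = int j - int m - 1" for j by (simp add: start_pos_def n_def)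
  have range: "1 \<le> \<pi> j" "\<pi> j \<le> n" if "j \<in> {1..n}" for j
    using permutes_in_image[OF perm, of j] that by auto
  \<comment> \<open>The lower bound on \<open>\<pi> j\<close> is automatic when
    \<open>\<pi> j > m\<close> and the upper one when \<open>\<pi> j \<le> m\<close>; what remains
    is that \<open>\<pi> j\<close> and \<open>j\<close> differ by at most \<open>m\<close>.\<close>
  have top: "toppleable n (m + 1) \<pi> \<longleftrightarrow> (\<forall>j\<in>{1..n}. j \<le> \<pi> j + m \<and> \<pi> j \<le> j + m)"
    unfolding toppleable_iff[OF perm n(3)] start
  proof (rule ball_cong[OF refl])
    fix j assume "j \<in> {1..n}"
    with range[OF this] show "int j - int m - 1 < int (chip_label (m + 1) (\<pi> j)) \<and>
        int (chip_label (m + 1) (\<pi> j)) < int j - int m - 1 + int n + 2 \<longleftrightarrow>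
        j \<le> \<pi> j + m \<and> \<pi> j \<le> j + m"
      unfolding chip_label_def atLeastAtMost_iff n_def by (cases "\<pi> j < m + 1") auto
  qed
  show "toppleable (2 * m + 1) (m + 1) \<pi> \<longleftrightarrow>
      (\<forall>i\<in>{1..m}. \<pi> i \<le> m + i) \<and> (\<forall>i\<in>{m + 1..2 * m + 1}. \<pi> i \<ge> i - m)"
    unfolding n_def[symmetric] top ball_split[OF n(1)]
  \<comment> \<open>For \<open>j \<le> m\<close> the lower bound holds because
    \<open>\<pi> j\<close> is at least 1, for \<open>j > m\<close> the upper one because
    \<open>\<pi> j \<le> 2 * m + 1\<close>.\<close>
  proof (rule ball_cong[OF refl])
    fix j assume "j \<in> {1..n}"
    with range[OF this] show "j \<le> \<pi> j + m \<and> \<pi> j \<le> j + m \<longleftrightarrow>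
        (if j \<le> m then \<pi> j \<le> m + j else \<pi> j \<ge> j - m)"
      unfolding atLeastAtMost_iff n_def by auto
  qed
  have inv: "(\<forall>i\<in>{1..n}. if i \<le> m + 1 then inv \<pi> i \<in> {1..m + i} else inv \<pi> i \<in> {i - m..n}) \<longleftrightarrow>
      (\<forall>j\<in>{1..n}. if \<pi> j \<le> m + 1 then j \<in> {1..m + \<pi> j} else j \<in> {\<pi> j - m..n})"
    by (rule ball_permutes_inv[OF perm])
  have "m + 2 = m + 1 + 1" by simp
  show "toppleable (2 * m + 1) (m + 1) \<pi> \<longleftrightarrow>
      (\<forall>i\<in>{1..m + 1}. inv \<pi> i \<in> {1..m + i}) \<and>
      (\<forall>i\<in>{m + 2..2 * m + 1}. inv \<pi> i \<in> {i - m..2 * m + 1})"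
    unfolding n_def[symmetric] top \<open>m + 2 = m + 1 + 1\<close> ball_split[OF n(2)] inv
  proof (rule ball_cong[OF refl])
    fix j assume "j \<in> {1..n}"
    with range[OF this] show "j \<le> \<pi> j + m \<and> \<pi> j \<le> j + m \<longleftrightarrow>
        (if \<pi> j \<le> m + 1 then j \<in> {1..m + \<pi> j} else j \<in> {\<pi> j - m..n})"
      unfolding atLeastAtMost_iff n_def by auto
  qed
next
  fix \<pi> :: "nat \<Rightarrow> nat" assume perm: "\<pi> permutes {1..2 * m}"
  define n where "n = 2 * m"
  note perm = perm[folded n_def]
  have n: "m \<le> n" "m + 1 \<in> chips n" by (auto simp: n_def)
  have "(int n - 1) div 2 = int m - 1" by (simp add: n_def)
  then have start: "start_pos n j = int j - int m" for j by (simp add: start_pos_def)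
  have range: "1 \<le> \<pi> j" "\<pi> j \<le> n" if "j \<in> {1..n}" for j
    using permutes_in_image[OF perm, of j] that by auto
  \<comment> \<open>The start positions now run from \<open>1 - m\<close> to \<open>m\<close>, so
    the lower bound is strict for entries up to \<open>m\<close>; for larger entries the relabelling
    by one makes it weak again.\<close>
  have top: "toppleable n (m + 1) \<pi> \<longleftrightarrow> (\<forall>j\<in>{1..n}. j \<le> \<pi> j + m \<and> (m < \<pi> j \<or> j < \<pi> j + m) \<and> \<pi> j \<le> j + m)"
    unfolding toppleable_iff[OF perm n(2)] start
  proof (rule ball_cong[OF refl])
    fix j assume "j \<in> {1..n}"
    with range[OF this] show "int j - int m < int (chip_label (m + 1) (\<pi> j)) \<and>
        int (chip_label (m + 1) (\<pi> j)) < int j - int m + int n + 2 \<longleftrightarrow>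
        j \<le> \<pi> j + m \<and> (m < \<pi> j \<or> j < \<pi> j + m) \<and> \<pi> j \<le> j + m"
      unfolding chip_label_def atLeastAtMost_iff n_def by (cases "\<pi> j < m + 1") auto
  qed
  show "toppleable (2 * m) (m + 1) \<pi> \<longleftrightarrow>
      (\<forall>i\<in>{1..m}. \<pi> i \<le> m + i) \<and> (\<forall>i\<in>{m + 1..2 * m}. \<pi> i \<ge> i - m + 1)"
    unfolding n_def[symmetric] top ball_split[OF n(1)]
  \<comment> \<open>Entries above \<open>m\<close> meet the strict bound
    \<open>j < \<pi> j + m\<close> too, since \<open>j \<le> 2 * m\<close>; hence the uniform
    \<open>+ 1\<close>.\<close>
  proof (rule ball_cong[OF refl])
    fix j assume "j \<in> {1..n}"
    with range[OF this] show "j \<le> \<pi> j + m \<and> (m < \<pi> j \<or> j < \<pi> j + m) \<and> \<pi> j \<le> j + m \<longleftrightarrow>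
        (if j \<le> m then \<pi> j \<le> m + j else \<pi> j \<ge> j - m + 1)"
      unfolding atLeastAtMost_iff n_def by auto
  qed
  have inv: "(\<forall>i\<in>{1..n}. if i \<le> m then inv \<pi> i \<in> {1..m + i - 1} else inv \<pi> i \<in> {i - m..n}) \<longleftrightarrow>
      (\<forall>j\<in>{1..n}. if \<pi> j \<le> m then j \<in> {1..m + \<pi> j - 1} else j \<in> {\<pi> j - m..n})"
    by (rule ball_permutes_inv[OF perm])
  show "toppleable (2 * m) (m + 1) \<pi> \<longleftrightarrow>
      (\<forall>i\<in>{1..m}. inv \<pi> i \<in> {1..m + i - 1}) \<and>
      (\<forall>i\<in>{m + 1..2 * m}. inv \<pi> i \<in> {i - m..2 * m})"
    unfolding n_def[symmetric] top ball_split[OF n(1)] inv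
  proof (rule ball_cong[OF refl])
    fix j assume "j \<in> {1..n}"
    with range[OF this] show "j \<le> \<pi> j + m \<and> (m < \<pi> j \<or> j < \<pi> j + m) \<and> \<pi> j \<le> j + m \<longleftrightarrow>
        (if \<pi> j \<le> m then j \<in> {1..m + \<pi> j - 1} else j \<in> {\<pi> j - m..n})"
      unfolding atLeastAtMost_iff n_def by auto
  qed
qed

end
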